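(* Consider the workforce planning problem with horizon $T\ge 1$ described in the context, with value functions $C_t:\mathbb{N}\to\mathbb{R}$ and functions $G_t:\mathbb{N}\to\mathbb{R}$. Then for every period $t=1,\dots,T$ the functions $G_t$ and $C_t$ are $K$-convex, where $K$ is the fixed hiring cost, and the optimal hiring policy in period $t$ is of $(s,S)$ type: there exist $s_t,S_t\in\mathbb{N}$ with $s_t\le S_t$ such that, for every staffing level $x_{t-1}\in\mathbb{N}$ at the beginning of period $t$, the hiring quantity $$q_t^\ast=\begin{cases} S_t-x_{t-1}, & x_{t-1}<s_t,\\ 0, & x_{t-1}\ge s_t,\end{cases}$$ is optimal, i.e. $y=x_{t-1}+q_t^\ast$ attains the minimum in the Bellman equation defining $C_t(x_{t-1})$.
   Context: $\mathbb{N}=\{0,1,2,\dots\}$ and $(z)^+=\max(z,0)$. Problem data: a horizon $T\ge1$; a fixed hiring cost $K\ge 0$; a unit hiring cost $c\ge 0$; a salary $h>0$ per staff member per period; a unit shortage penalty $\pi>0$; for each period $t\in\{1,\dots,T\}$ a minimum staffing requirement $W_t\in\mathbb{N}$ and a turnover probability $p_t\in[0,1]$. Dynamics: at the beginning of period $t$ the staffing level is $x_{t-1}\in\mathbb{N}$; one chooses a hiring quantity $q_t\in\mathbb{N}$, giving the post-hiring level $y_t=x_{t-1}+q_t$; then $\omega_t^{y_t}$ staff leave, where $\omega_t^{y}\sim\mathrm{Binomial}(y,p_t)$, and $x_t=y_t-\omega_t^{y_t}$. Costs: the hiring cost is $\delta(z)=K+cz$ for $z>0$ and $\delta(0)=0$.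 The expected salary and penalty cost in period $t$ is $$L_t(y)=h\,y(1-p_t)+\pi\,\mathbb{E}\big[(\omega_t^y+W_t-y)^+\big],\qquad y\in\mathbb{N}.$$ Bellman equation: $C_{T+1}\equiv 0$ and, for $t=T,T-1,\dots,1$ and $x\in\mathbb{N}$, $$C_t(x)=\min_{y\in\mathbb{N},\,y\ge x}\Big\{\delta(y-x)+L_t(y)+\mathbb{E}\big[C_{t+1}(y-\omega_t^y)\big]\Big\}.$$ Also $$G_t(y)=cy+L_t(y)+\mathbb{E}\big[C_{t+1}(y-\omega_t^y)\big],\qquad y\in\mathbb{N}.$$ $K$-convexity: a function $f:\mathbb{N}\to\mathbb{R}$ is $K$-convex if for all $x,a,b\in\mathbb{N}$ with $x-b\in\mathbb{N}$, $$b\big(K+f(x+a)-f(x)\big)\ge a\big(f(x)-f(x-b)\big).$$ *)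

theory Defs
  imports "HOL-Probability.Probability"
begin

definition K_convex :: "real \<Rightarrow> (nat \<Rightarrow> real) \<Rightarrow> bool" where
  "K_convex K f \<longleftrightarrow> (\<forall>x a b. b \<le> x \<longrightarrow>
     real b * (K + f (x + a) - f x) \<ge> real a * (f x - f (x - b)))"

definition hiring_cost :: "real \<Rightarrow> real \<Rightarrow> nat \<Rightarrow> real" where
  "hiring_cost K c z = (if z > 0 then K + c * real z else 0)"

definition period_cost ::
  "real \<Rightarrow> real \<Rightarrow> (nat \<Rightarrow> nat) \<Rightarrow> (nat \<Rightarrow> real) \<Rightarrow> nat \<Rightarrow> nat \<Rightarrow> real" where
  "period_cost h \<pi> W p t y =
     h * real y * (1 - p t) +
     \<pi> * measure_pmf.expectation (binomial_pmf y (p t))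
           (\<lambda>\<omega>. max (real \<omega> + real (W t) - real y) 0)"

text \<open>
  The expected continuation cost after hiring up to \<open>y\<close> in period \<open>t\<close>. The truncated
  subtraction \<open>y - \<omega>\<close> is harmless, because \<open>\<omega> \<le> y\<close> on the support of the binomial distribution.
\<close>

definition expected_future ::
  "(nat \<Rightarrow> real) \<Rightarrow> nat \<Rightarrow> (nat \<Rightarrow> real) \<Rightarrow> nat \<Rightarrow> real" where
  "expected_future p t V y =
     measure_pmf.expectation (binomial_pmf y (p t)) (\<lambda>\<omega>. V (y - \<omega>))"

text \<open>
  The expression minimised over \<open>y \<ge> x\<close> in the Bellman equation of period \<open>t\<close>, where \<open>V\<close> is
  the value function of period \<open>t + 1\<close>.
\<close>

definition bellman_cost ::
  "real \<Rightarrow> real \<Rightarrow> real \<Rightarrow> real \<Rightarrow> (nat \<Rightarrow> nat) \<Rightarrow> (nat \<Rightarrow> real)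
    \<Rightarrow> nat \<Rightarrow> (nat \<Rightarrow> real) \<Rightarrow> nat \<Rightarrow> nat \<Rightarrow> real" where
  "bellman_cost K c h \<pi> W p t V x y =
     hiring_cost K c (y - x) + period_cost h \<pi> W p t y + expected_future p t V y"

text \<open>
  The value functions. The minimum over the infinite set of all \<open>y \<ge> x\<close> is written as an infimum,
  with which it coincides whenever it is attained. For the admissible problem data the costs are
  nonnegative, so this infimum is a genuine one.
\<close>

function value_fn ::
  "nat \<Rightarrow> real \<Rightarrow> real \<Rightarrow> real \<Rightarrow> real \<Rightarrow> (nat \<Rightarrow> nat) \<Rightarrow> (nat \<Rightarrow> real)
    \<Rightarrow> nat \<Rightarrow> nat \<Rightarrow> real" where
  "value_fn T K c h \<pi> W p t =
     (if t > T then (\<lambda>x. 0)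
      else (\<lambda>x. INF y\<in>{x..}. bellman_cost K c h \<pi> W p t (value_fn T K c h \<pi> W p (t + 1)) x y))"
  by pat_completeness auto
termination
  by (relation "Wellfounded.measure (\<lambda>(T, K, c, h, \<pi>, W, p, t). Suc T - t)") auto

declare value_fn.simps [simp del]

definition G_fn ::
  "nat \<Rightarrow> real \<Rightarrow> real \<Rightarrow> real \<Rightarrow> real \<Rightarrow> (nat \<Rightarrow> nat) \<Rightarrow> (nat \<Rightarrow> real)
    \<Rightarrow> nat \<Rightarrow> nat \<Rightarrow> real" where
  "G_fn T K c h \<pi> W p t y =
     c * real y + period_cost h \<pi> W p t y
       + expected_future p t (value_fn T K c h \<pi> W p (t + 1)) y"

definition sS_hiring :: "nat \<Rightarrow> nat \<Rightarrow> nat \<Rightarrow> nat" where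
  "sS_hiring s S x = (if x < s then S - x else 0)"

end

theory Submission
  imports Defs
begin

text \<open>
  Two facts carry the theorem. The first is that binomial thinning preserves \<open>K\<close>-convexity: if \<open>V\<close>
  is \<open>K\<close>-convex, then so is \<open>U y = E[V (X y)]\<close>, where \<open>X y\<close> counts the survivors among \<open>y\<close> staff
  members who stay independently with probability \<open>q\<close>. For \<open>u < v < w\<close> let the survivors be
  counted in nested groups, so that \<open>X u \<le> X v \<le> X w\<close>. Given \<open>X u\<close> and \<open>X w\<close>, each survivor outside
  the first group lies in the second one with probability \<open>(v - u) / (w - u)\<close>, hence \<open>X v - X u\<close>
  has the conditional mean \<open>(X w - X u) (v - u) / (w - u)\<close>. The \<open>K\<close>-convexity inequality of \<open>V\<close> at
  \<open>X u \<le> X v \<le> X w\<close> bounds \<open>V (X v)\<close> by an expression that is affine in \<open>X v\<close> once \<open>X u\<close> and \<open>X w\<close>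
  are given, so taking expectations yields the inequality of \<open>U\<close> at \<open>u, v, w\<close>. The fixed cost is
  paid with weight at most \<open>(v - u) / (w - u)\<close>. This is \<open>K_convex_binomial_mean\<close>; the only property
  of the hypergeometric law that it needs is the proportional mean, \<open>binomial_mean_share\<close>.

  The second fact is Scarf's argument. If \<open>G\<close> is \<open>K\<close>-convex with a global minimiser \<open>S\<close>, and \<open>s\<close> is
  the least level with \<open>G s \<le> G S + K\<close>, then raising the level never pays from \<open>s\<close> on, whereas
  below \<open>s\<close> it pays to go to \<open>S\<close> (\<open>K_convex_le_raised\<close>, \<open>hiring_cost_sS_le\<close>). The resulting cost
  function is again \<open>K\<close>-convex (\<open>K_convex_sS_truncation\<close>), which closes the backward induction.

  Minimisers exist because the value functions are nonnegative: with \<open>p < 1\<close> the salaries make \<open>G\<close>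
  grow at least linearly, and with \<open>p = 1\<close> everybody leaves, so that \<open>G\<close> is \<open>c y\<close> plus a constant.
\<close>

section \<open>Binomial averages\<close>

text \<open>
  The mean of \<open>f\<close> under the binomial distribution with \<open>n\<close> trials and success probability \<open>q\<close>,
  by conditioning on a single trial. The recursion makes all the identities below inductions.
\<close>

primrec binomial_mean :: "real \<Rightarrow> nat \<Rightarrow> (nat \<Rightarrow> real) \<Rightarrow> real" where
  "binomial_mean q 0 f = f 0"
| "binomial_mean q (Suc n) f = q * binomial_mean q n (\<lambda>k. f (Suc k)) + (1 - q) * binomial_mean q n f"

lemma expectation_binomial_pmf_Suc:
  fixes f :: "nat \<Rightarrow> real"
  assumes "p \<in> {0..1}"
  shows "measure_pmf.expectation (binomial_pmf (Suc n) p) f =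
    p * measure_pmf.expectation (binomial_pmf n p) (\<lambda>k. f (Suc k)) +
    (1 - p) * measure_pmf.expectation (binomial_pmf n p) f"
proof -
  have "binomial_pmf (Suc n) p =
      bernoulli_pmf p \<bind> (\<lambda>b. map_pmf (\<lambda>k. (if b then 1 else 0) + k) (binomial_pmf n p))"
    using assms by (simp add: binomial_pmf_Suc map_pmf_def)
  also have "measure_pmf.expectation \<dots> f = (\<Sum>b\<in>UNIV. pmf (bernoulli_pmf p) b *\<^sub>R
      measure_pmf.expectation (map_pmf (\<lambda>k. (if b then 1 else 0) + k) (binomial_pmf n p)) f)"
    using finite_set_pmf_binomial_pmf[OF assms] by (intro pmf_expectation_bind) auto
  also have "\<dots> = p * measure_pmf.expectation (binomial_pmf n p) (\<lambda>k. f (Suc k)) +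
      (1 - p) * measure_pmf.expectation (binomial_pmf n p) f"
    using assms by (simp add: UNIV_bool)
  finally show ?thesis .
qed

text \<open>
  Staff members who do not leave are the successes of the complementary trials.
\<close>

lemma expected_future_eq_binomial_mean:
  assumes "p t \<in> {0..1}"
  shows "expected_future p t V y = binomial_mean (1 - p t) y V"
proof (induction y arbitrary: V)
  case 0
  then show ?case
    using assms by (simp add: expected_future_def binomial_pmf_0)
next
  case (Suc y)
  have "measure_pmf.expectation (binomial_pmf y (p t)) (\<lambda>\<omega>. V (Suc y - \<omega>)) =
      measure_pmf.expectation (binomial_pmf y (p t)) (\<lambda>\<omega>. V (Suc (y - \<omega>)))"
    unfolding expectation_binomial_pmf'[OF assms]
    by (intro sum.cong refl) (simp add: Suc_diff_le)
  then show ?case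
    using Suc[of V] Suc[of "\<lambda>k. V (Suc k)"]
    by (simp add: expected_future_def expectation_binomial_pmf_Suc[where p = "p t", OF assms])
qed

lemma binomial_mean_const: "binomial_mean q n (\<lambda>k. r) = r"
  by (induction n) (simp_all add: algebra_simps)

lemma binomial_mean_add:
  "binomial_mean q n (\<lambda>k. f k + g k) = binomial_mean q n f + binomial_mean q n g"
proof (induction n arbitrary: f g)
  case (Suc n)
  show ?case by (simp only: binomial_mean.simps Suc) (simp only: algebra_simps)
qed simp

lemma binomial_mean_mult: "binomial_mean q n (\<lambda>k. r * f k) = r * binomial_mean q n f"
proof (induction n arbitrary: f)
  case (Suc n)
  show ?case by (simp only: binomial_mean.simps Suc) (simp only: algebra_simps)
qed simp

lemma binomial_mean_mono:
  assumes "q \<in> {0..1}" and "\<And>k. f k \<le> g k"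
  shows "binomial_mean q n f \<le> binomial_mean q n g"
  using assms(2)
proof (induction n arbitrary: f g)
  case 0
  then show ?case by simp
next
  case (Suc n)
  have "binomial_mean q n (\<lambda>k. f (Suc k)) \<le> binomial_mean q n (\<lambda>k. g (Suc k))"
    and "binomial_mean q n f \<le> binomial_mean q n g"
    by (intro Suc.IH Suc.prems)+
  moreover have "0 \<le> q" "0 \<le> 1 - q"
    using assms(1) by simp_all
  ultimately show ?case
    unfolding binomial_mean.simps by (intro add_mono mult_left_mono)
qed

lemma binomial_mean_split:
  "binomial_mean q (m + n) f = binomial_mean q m (\<lambda>i. binomial_mean q n (\<lambda>j. f (i + j)))"
  by (induction m arbitrary: f) simp_all

lemma binomial_mean_zero_prob: "binomial_mean 0 n f = f 0"
  by (induction n arbitrary: f) simp_all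

text \<open>
  Size biasing: weighting by the number of successes makes one trial a sure success.
\<close>

lemma binomial_mean_size_bias:
  "binomial_mean q (Suc n) (\<lambda>k. real k * f k) =
    real (Suc n) * q * binomial_mean q n (\<lambda>k. f (Suc k))"
proof (induction n arbitrary: f)
  case 0
  then show ?case by simp
next
  case (Suc n)
  have "binomial_mean q (Suc (Suc n)) (\<lambda>k. real k * f k) =
      q * binomial_mean q (Suc n) (\<lambda>k. real k * f (Suc k) + f (Suc k)) +
      (1 - q) * binomial_mean q (Suc n) (\<lambda>k. real k * f k)"
    by (subst binomial_mean.simps(2)) (simp add: algebra_simps)
  also have "\<dots> = q * (real (Suc n) * q * binomial_mean q n (\<lambda>k. f (Suc (Suc k)))
        + binomial_mean q (Suc n) (\<lambda>k. f (Suc k)))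
      + (1 - q) * (real (Suc n) * q * binomial_mean q n (\<lambda>k. f (Suc k)))"
    by (simp only: binomial_mean_add Suc)
  also have "\<dots> = real (Suc (Suc n)) * q * binomial_mean q (Suc n) (\<lambda>k. f (Suc k))"
    by (simp add: algebra_simps)
  finally show ?case .
qed

text \<open>
  Among \<open>b + a\<close> trials, the first \<open>b\<close> contribute on average the fraction \<open>b / (b + a)\<close> of the
  successes, even given the total number of successes. Here \<open>g\<close> is an arbitrary function of
  that total. Both sides reduce to the same average by size biasing.
\<close>

lemma binomial_mean_share:
  "real (b + a) * binomial_mean q b (\<lambda>j. binomial_mean q a (\<lambda>l. real j * g (j + l))) =
    real b * binomial_mean q (b + a) (\<lambda>n. real n * g n)"
proof (cases b)
  case 0
  then show ?thesis by (simp add: binomial_mean_const)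
next
  case (Suc b')
  have "binomial_mean q b (\<lambda>j. binomial_mean q a (\<lambda>l. real j * g (j + l))) =
      binomial_mean q (Suc b') (\<lambda>j. real j * binomial_mean q a (\<lambda>l. g (j + l)))"
    by (simp only: Suc binomial_mean_mult)
  also have "\<dots> = real b * q * binomial_mean q (b' + a) (\<lambda>n. g (Suc n))"
    unfolding binomial_mean_size_bias by (simp add: Suc binomial_mean_split)
  finally have "binomial_mean q b (\<lambda>j. binomial_mean q a (\<lambda>l. real j * g (j + l))) =
      real b * q * binomial_mean q (b' + a) (\<lambda>n. g (Suc n))" .
  moreover have "binomial_mean q (b + a) (\<lambda>n. real n * g n) =
      real (b + a) * q * binomial_mean q (b' + a) (\<lambda>n. g (Suc n))"
    using binomial_mean_size_bias[of q "b' + a" g] by (simp only: Suc add_Suc)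
  ultimately show ?thesis by simp
qed

section \<open>K-convexity\<close>

lemma K_convexD:
  assumes "K_convex K f" and "b \<le> x"
  shows "real b * (K + f (x + a) - f x) \<ge> real a * (f x - f (x - b))"
  using assms by (simp add: K_convex_def)

text \<open>
  With the three points written as \<open>i \<le> i + j \<le> i + j + l\<close>, the inequality bounds the middle value
  by an interpolation of the outer ones.
\<close>

lemma K_convex_interpolation:
  assumes "K_convex K f"
  shows "real (j + l) * (f (i + j) - f i) \<le> real j * (K + f (i + (j + l)) - f i)"
  using K_convexD[OF assms, of j "i + j" l] by (simp add: algebra_simps)

lemma K_convexI_interpolation:
  assumes "\<And>i j l. real (j + l) * (f (i + j) - f i) \<le> real j * (K + f (i + (j + l)) - f i)"
  shows "K_convex K f"
  unfolding K_convex_def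
proof (intro allI impI)
  fix x a b :: nat
  assume "b \<le> x"
  then show "real b * (K + f (x + a) - f x) \<ge> real a * (f x - f (x - b))"
    using assms[of b a "x - b"] by (simp add: algebra_simps)
qed

lemma K_convex_add:
  assumes "K_convex K f" and "K_convex L g"
  shows "K_convex (K + L) (\<lambda>x. f x + g x)"
  unfolding K_convex_def
proof (intro allI impI)
  fix x a b :: nat
  assume "b \<le> x"
  then show "real b * (K + L + (f (x + a) + g (x + a)) - (f x + g x))
      \<ge> real a * (f x + g x - (f (x - b) + g (x - b)))"
    using K_convexD[OF assms(1), of b x a] K_convexD[OF assms(2), of b x a]
    by (simp add: algebra_simps)
qed

lemma K_convex_linear: "K_convex 0 (\<lambda>x. r * real x)"
  unfolding K_convex_def by (simp add: algebra_simps of_nat_diff)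

text \<open>
  The shortage \<open>(w - z)\<^sup>+\<close> is convex in \<open>z\<close>: it vanishes at \<open>z\<close> or is linear to the left of \<open>z\<close>,
  and its slopes lie between \<open>-1\<close> and \<open>0\<close>.
\<close>

lemma K_convex_shortage:
  assumes "r \<ge> 0"
  shows "K_convex 0 (\<lambda>z. r * max (w - real z) 0)"
  unfolding K_convex_def
proof (intro allI impI)
  fix x a b :: nat
  assume b: "b \<le> x"
  define f where "f z = max (w - real z) 0" for z
  have "real b * (f (x + a) - f x) \<ge> real a * (f x - f (x - b))"
  proof (cases "w \<le> real x")
    case True
    then have "f x = 0" by (simp add: f_def)
    moreover have "f (x + a) \<ge> 0" "f (x - b) \<ge> 0" by (simp_all add: f_def)
    ultimately show ?thesis
      by (simp add: order_trans[of "- (real a * f (x - b))" 0])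
  next
    case False
    then have left_slope: "f x - f (x - b) = - real b"
      using b by (simp add: f_def of_nat_diff)
    have "real b * (- real a) \<le> real b * (f (x + a) - f x)"
      using False by (intro mult_left_mono) (simp_all add: f_def)
    then show ?thesis
      unfolding left_slope by (simp only: mult_minus_right mult.commute[of "real a"])
  qed
  then have "r * (real b * (f (x + a) - f x)) \<ge> r * (real a * (f x - f (x - b)))"
    using assms by (rule mult_left_mono)
  then show "real b * (0 + r * max (w - real (x + a)) 0 - r * max (w - real x) 0)
      \<ge> real a * (r * max (w - real x) 0 - r * max (w - real (x - b)) 0)"
    unfolding f_def by (simp only: algebra_simps)
qed

text \<open>
  The thinning step. The survivors are counted by \<open>i\<close> in a first group, by \<open>j\<close> among \<open>b\<close> further
  staff members and by \<open>l\<close> among another \<open>a\<close>. For fixed \<open>i\<close> the interpolation bound at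
  \<open>i \<le> i + j \<le> i + j + l\<close> is \<open>j\<close> times a function \<open>g\<close> of the total \<open>j + l\<close>, so the proportional mean
  replaces \<open>j\<close> by \<open>(j + l) b / (b + a)\<close>; averaging over \<open>i\<close> finishes the proof. If \<open>j + l = 0\<close>,
  then \<open>g\<close> is a division by zero, but both sides of the bound are \<open>0\<close>.
\<close>

lemma K_convex_binomial_mean:
  assumes V: "K_convex K V" and K: "K \<ge> 0" and q: "q \<in> {0..1}"
  shows "K_convex K (\<lambda>y. binomial_mean q y V)"
proof (rule K_convexI_interpolation)
  fix m b a :: nat
  let ?E = "binomial_mean q"
  have fixed_i: "real (b + a) * (?E b (\<lambda>j. V (i + j)) - V i)
      \<le> real b * (K + ?E (b + a) (\<lambda>n. V (i + n)) - V i)" for i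
  proof -
    define D where "D n = V (i + n) + (- V i)" for n
    define g where "g n = (K + D n) / real n" for n
    have "D j \<le> real j * g (j + l)" for j l
    proof (cases "j + l = 0")
      case True
      then show ?thesis by (simp add: D_def)
    next
      case False
      then have "real (j + l) > 0" by (simp del: of_nat_add)
      moreover have "D j * real (j + l) \<le> real j * (K + D (j + l))"
        using K_convex_interpolation[OF V, of j l i] by (simp add: D_def algebra_simps)
      ultimately show ?thesis
        by (simp only: g_def pos_le_divide_eq times_divide_eq_right)
    qed
    then have "?E b (\<lambda>j. ?E a (\<lambda>l. D j)) \<le> ?E b (\<lambda>j. ?E a (\<lambda>l. real j * g (j + l)))"
      by (intro binomial_mean_mono q)
    then have "real (b + a) * ?E b D \<le> real b * ?E (b + a) (\<lambda>n. real n * g n)"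
      unfolding binomial_mean_const binomial_mean_share[symmetric]
      by (intro mult_left_mono) simp_all
    also have "\<dots> \<le> real b * ?E (b + a) (\<lambda>n. K + D n)"
    proof (intro mult_left_mono binomial_mean_mono q)
      show "real n * g n \<le> K + D n" for n
        using K by (cases "n = 0") (simp_all add: g_def D_def)
    qed simp
    finally show ?thesis
      unfolding D_def binomial_mean_add binomial_mean_const by (simp add: algebra_simps)
  qed
  define U1 where "U1 i = ?E b (\<lambda>j. V (i + j))" for i
  define U2 where "U2 i = ?E (b + a) (\<lambda>n. V (i + n))" for i
  have "?E m (\<lambda>i. real (b + a) * (U1 i + (-1) * V i)) \<le> ?E m (\<lambda>i. real b * (K + (U2 i + (-1) * V i)))"
    using fixed_i by (intro binomial_mean_mono q) (simp add: U1_def U2_def algebra_simps)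
  then have "real (b + a) * (?E m U1 + (-1) * ?E m V) \<le> real b * (K + (?E m U2 + (-1) * ?E m V))"
    unfolding binomial_mean_mult binomial_mean_add binomial_mean_const .
  then show "real (b + a) * (?E (m + b) V - ?E m V) \<le> real b * (K + ?E (m + (b + a)) V - ?E m V)"
    unfolding binomial_mean_split[of q m] U1_def U2_def by (simp add: add_diff_eq)
qed

section \<open>Optimality of (s, S) policies\<close>

text \<open>
  Once it is worth not ordering at \<open>s\<close>, it is worth not ordering at any higher level. Between \<open>s\<close>
  and \<open>S\<close> the value \<open>G x\<close> lies below an interpolation of \<open>G s\<close> and \<open>K + G S\<close>. Beyond \<open>S\<close>, a drop of
  more than \<open>K\<close> would contradict the \<open>K\<close>-convexity, because \<open>G\<close> has not decreased from \<open>S\<close> to \<open>x\<close>.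
\<close>

lemma K_convex_le_raised:
  assumes G: "K_convex K G" and K: "K \<ge> 0" and S: "\<And>y. G S \<le> G y"
    and s: "s \<le> S" "G s \<le> K + G S" and "s \<le> x" "x \<le> y"
  shows "G x \<le> K + G y"
proof (cases "x \<le> S")
  case True
  have "G x \<le> K + G S"
  proof (cases "s < S")
    case True
    have "real (S - s) * (G x - G s) \<le> real (x - s) * (K + G S - G s)"
      using K_convex_interpolation[OF G, of "x - s" "S - x" s] \<open>s \<le> x\<close> \<open>x \<le> S\<close> by simp
    also have "\<dots> \<le> real (S - s) * (K + G S - G s)"
      using s \<open>x \<le> S\<close> by (intro mult_right_mono) simp_all
    finally show ?thesis
      using True by simp
  next
    case False
    then have "x = S" using \<open>s \<le> x\<close> \<open>x \<le> S\<close> by simp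
    then show ?thesis using K by simp
  qed
  then show ?thesis using S[of y] by simp
next
  case False
  have "0 \<le> real (y - x) * (G x - G S)"
    using S[of x] by simp
  also have "\<dots> \<le> real (x - S) * (K + G y - G x)"
    using K_convexD[OF G, of "x - S" x "y - x"] False \<open>x \<le> y\<close> by simp
  finally show ?thesis
    using False by (simp add: zero_le_mult_iff)
qed

text \<open>
  Below \<open>s\<close> the optimal cost is the constant \<open>K + G S\<close>. The delicate case of \<open>K\<close>-convexity is that
  only the left point \<open>x - b\<close> lies below \<open>s\<close>. If \<open>G x\<close> exceeds this constant, then \<open>x > S\<close>, and the
  inequality follows from that of \<open>G\<close> with the left point moved up to \<open>S\<close>.
\<close>

lemma K_convex_sS_truncation:
  assumes G: "K_convex K G" and K: "K \<ge> 0" and S: "\<And>y. G S \<le> G y"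
    and s: "s \<le> S" "G s \<le> K + G S"
  shows "K_convex K (\<lambda>x. if x < s then K + G S else G x)"
proof -
  define H where "H x = (if x < s then K + G S else G x)" for x
  have raised: "G x \<le> K + G y" if "s \<le> x" "x \<le> y" for x y
    using K_convex_le_raised[OF G K S s that] .
  have "real b * (K + H (x + a) - H x) \<ge> real a * (H x - H (x - b))" if b: "b \<le> x" for x a b
  proof -
    consider "s \<le> x - b" | "x < s" | "x - b < s" "s \<le> x" "G x \<le> K + G S"
      | "x - b < s" "s \<le> x" "G x > K + G S"
      by linarith
    then show ?thesis
    proof cases
      case 1
      then have "\<not> x - b < s" "\<not> x < s" "\<not> x + a < s"
        by linarith+
      then show ?thesis
        using K_convexD[OF G b] by (simp only: H_def if_False)
    next
      case 2
      then have "H x = K + G S" "H (x - b) = K + G S"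
        by (auto simp: H_def)
      moreover have "H (x + a) \<ge> G S"
        using S K by (simp add: H_def)
      ultimately show ?thesis
        by simp
    next
      case 3
      then have "real a * (H x - H (x - b)) \<le> 0"
        by (simp add: H_def mult_nonneg_nonpos)
      moreover have "real b * (K + H (x + a) - H x) \<ge> 0"
        using 3 raised[of x "x + a"] by (simp add: H_def)
      ultimately show ?thesis by linarith
    next
      case 4
      have "S < x"
        using 4 raised[of x S] by (meson leD leI)
      have "real a * (H x - H (x - b)) \<le> real a * (G x - G S)"
        using 4 K by (intro mult_left_mono) (simp_all add: H_def)
      also have "\<dots> \<le> real (x - S) * (K + G (x + a) - G x)"
        using K_convexD[OF G, of "x - S" x a] \<open>S < x\<close> by simp
      also have "\<dots> \<le> real b * (K + G (x + a) - G x)"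
        using 4 s b raised[of x "x + a"] by (intro mult_right_mono) simp_all
      also have "\<dots> = real b * (K + H (x + a) - H x)"
        using 4 by (simp add: H_def)
      finally show ?thesis .
    qed
  qed
  then show ?thesis
    unfolding K_convex_def H_def by blast
qed

text \<open>
  Up to the constant \<open>- c x\<close>, the two sides are the Bellman costs of following the policy and of
  hiring up to \<open>y\<close>, since the unit costs \<open>c (y - x)\<close> are part of \<open>G\<close>.
\<close>

lemma hiring_cost_sS_le:
  assumes G: "K_convex K G" and K: "K \<ge> 0" and S: "\<And>y. G S \<le> G y"
    and s: "s \<le> S" "G s \<le> K + G S" and below: "\<And>x. x < s \<Longrightarrow> K + G S < G x"
    and "x \<le> y"
  shows "(if x < s then K + G S else G x) \<le> (if x < y then K else 0) + G y"
  using K_convex_le_raised[OF G K S s, of x y] S[of y] below[of x] \<open>x \<le> y\<close>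
  by (cases "x = y") auto

section \<open>One period of the Bellman recursion\<close>

lemma ex_minimizer_nat_linear_growth:
  fixes f :: "nat \<Rightarrow> real"
  assumes "r > 0" and growth: "\<And>y. r * real y \<le> f y"
  obtains S where "\<And>y. f S \<le> f y"
proof -
  obtain N where N: "f 0 < real N * r"
    using reals_Archimedean3[OF \<open>r > 0\<close>] by blast
  define S where "S = arg_min_on f {..N}"
  have S: "f S \<le> f y" if "y \<le> N" for y
    unfolding S_def using that by (intro arg_min_least) auto
  have "f S \<le> f y" for y
  proof (cases "y \<le> N")
    case False
    have "f S \<le> f 0" by (rule S) simp
    also have "\<dots> \<le> r * real N" using N by (simp add: mult.commute)
    also have "\<dots> \<le> r * real y" using False \<open>r > 0\<close> by simp
    also have "\<dots> \<le> f y" by (rule growth)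
    finally show ?thesis .
  qed (rule S)
  then show ?thesis using that by blast
qed

text \<open>
  The penalty depends on the leavers only through the number of survivors, so it is a thinned
  average of a convex function and \<open>K_convex_binomial_mean\<close> applies to it.
\<close>

lemma period_cost_eq:
  assumes "p t \<in> {0..1}"
  shows "period_cost h \<pi> W p t y = h * (1 - p t) * real y +
    binomial_mean (1 - p t) y (\<lambda>z. \<pi> * max (real (W t) - real z) 0)"
proof -
  have "measure_pmf.expectation (binomial_pmf y (p t)) (\<lambda>\<omega>. max (real \<omega> + real (W t) - real y) 0) =
      expected_future p t (\<lambda>z. max (real (W t) - real z) 0) y"
    unfolding expected_future_def expectation_binomial_pmf'[OF assms]
    by (intro sum.cong refl arg_cong2[where f = scaleR] arg_cong2[where f = max]) (simp add: of_nat_diff)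
  then show ?thesis
    by (simp only: period_cost_def binomial_mean_mult
      expected_future_eq_binomial_mean[where p = p, OF assms] mult.assoc mult.commute[of "real y"])
qed

lemma binomial_mean_nonneg:
  assumes "q \<in> {0..1}" and "\<And>k. f k \<ge> 0"
  shows "binomial_mean q n f \<ge> 0"
  using binomial_mean_mono[OF assms(1), of "\<lambda>k. 0" f n] assms(2) by (simp add: binomial_mean_const)

text \<open>
  Nonnegativity and \<open>K\<close>-convexity of the continuation \<open>V\<close> form the invariant of the backward
  induction: the former gives the minimiser \<open>S\<close>, the latter the policy, and \<open>C\<close> inherits both.
  Penalty and continuation are thinned together, as the average of the single function \<open>R\<close>.
\<close>

lemma bellman_step:
  fixes V :: "nat \<Rightarrow> real" and K c h \<pi> :: real and W :: "nat \<Rightarrow> nat"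
  assumes K: "K \<ge> 0" and c: "c \<ge> 0" and h: "h > 0" and \<pi>: "\<pi> > 0" and p: "p t \<in> {0..1}"
    and V: "K_convex K V" and V_nonneg: "\<And>x. V x \<ge> 0"
  defines "G \<equiv> \<lambda>y. c * real y + period_cost h \<pi> W p t y + expected_future p t V y"
    and "J \<equiv> bellman_cost K c h \<pi> W p t V"
    and "C \<equiv> \<lambda>x. INF y\<in>{x..}. bellman_cost K c h \<pi> W p t V x y"
  shows "K_convex K G" and "K_convex K C" and "\<And>x. C x \<ge> 0"
    and "\<exists>s S. s \<le> S \<and> (\<forall>x. is_arg_min (J x) (\<lambda>y. y \<ge> x) (x + sS_hiring s S x) \<and>
      C x = J x (x + sS_hiring s S x))"
proof -
  define q where "q = 1 - p t"
  have q: "q \<in> {0..1}" using p by (simp add: q_def)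
  define R where "R z = \<pi> * max (real (W t) - real z) 0 + V z" for z
  have R_nonneg: "R z \<ge> 0" for z
    using V_nonneg \<pi> by (simp add: R_def)
  have G_eq: "G y = (c + h * q) * real y + binomial_mean q y R" for y
    unfolding G_def R_def period_cost_eq[where p = p, OF p] expected_future_eq_binomial_mean[where p = p, OF p] q_def
      binomial_mean_add by (simp add: algebra_simps)
  have J_eq: "J x y = (if x < y then K else 0) + G y - c * real x" if "x \<le> y" for x y
    using that by (auto simp: J_def G_def bellman_cost_def hiring_cost_def of_nat_diff algebra_simps)
  have "K_convex K R"
    using K_convex_add[OF K_convex_shortage[of \<pi>] V] \<pi> by (simp add: R_def[abs_def])
  then have "K_convex K (\<lambda>y. binomial_mean q y R)"
    using K q by (rule K_convex_binomial_mean)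
  from K_convex_add[OF K_convex_linear this] show G: "K_convex K G"
    by (simp add: G_eq[abs_def])
  obtain S where S: "\<And>y. G S \<le> G y"
  proof (cases "q = 0")
    case True
    then have "G 0 \<le> G y" for y
      using c by (simp add: G_eq binomial_mean_zero_prob)
    then show ?thesis using that by blast
  next
    case False
    then have "c + h * q > 0"
      using q h c by (simp add: add_nonneg_pos)
    moreover have "(c + h * q) * real y \<le> G y" for y
      using binomial_mean_nonneg[OF q R_nonneg] by (simp add: G_eq)
    ultimately show ?thesis
      using that by (rule ex_minimizer_nat_linear_growth)
  qed
  define s where "s = (LEAST x. G x \<le> K + G S)"
  have s: "s \<le> S" "G s \<le> K + G S"
    unfolding s_def using K by (auto intro: Least_le LeastI[of _ S])
  have below: "K + G S < G x" if "x < s" for x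
    using not_less_Least[of x "\<lambda>x. G x \<le> K + G S"] that by (simp add: s_def)
  define H where "H x = (if x < s then K + G S else G x)" for x
  have policy_cost: "J x (x + sS_hiring s S x) = H x - c * real x" for x
    using s by (simp add: J_eq sS_hiring_def H_def)
  have policy_le: "J x (x + sS_hiring s S x) \<le> J x y" if "x \<le> y" for x y
    using hiring_cost_sS_le[OF G K S s below that] that by (simp only: policy_cost J_eq H_def) simp
  have C_policy: "C x = J x (x + sS_hiring s S x)" for x
    unfolding C_def J_def[symmetric]
    by (rule cInf_eq_minimum) (auto intro: policy_le)
  show "\<exists>s S. s \<le> S \<and> (\<forall>x. is_arg_min (J x) (\<lambda>y. y \<ge> x) (x + sS_hiring s S x) \<and>
      C x = J x (x + sS_hiring s S x))"
  proof (intro exI conjI allI)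
    show "s \<le> S" by (rule s(1))
    show "is_arg_min (J x) (\<lambda>y. y \<ge> x) (x + sS_hiring s S x)" for x
      using policy_le by (simp add: is_arg_min_linorder)
    show "C x = J x (x + sS_hiring s S x)" for x
      by (rule C_policy)
  qed
  have "C = (\<lambda>x. H x + (- c) * real x)"
    using C_policy policy_cost by (intro ext) simp
  moreover have "K_convex K H"
    using K_convex_sS_truncation[OF G K S s] by (simp add: H_def[abs_def])
  ultimately show "K_convex K C"
    using K_convex_add[OF _ K_convex_linear, of K H "- c"] by simp
  show "C x \<ge> 0" for x
  proof -
    let ?y = "x + sS_hiring s S x"
    \<comment> \<open>The unit costs of the staff already present, which are subtracted, are contained in \<open>G\<close>.\<close>
    have "c * real x \<le> (c + h * q) * real ?y"
      using c h q by (intro mult_mono) auto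
    also have "\<dots> \<le> G ?y"
      using binomial_mean_nonneg[OF q R_nonneg] by (simp add: G_eq)
    finally have "c * real x \<le> G ?y" .
    moreover have "C x = (if x < ?y then K else 0) + G ?y - c * real x"
      unfolding C_policy by (rule J_eq) simp
    ultimately show ?thesis
      using K by (simp split: if_split_asm)
  qed
qed

section \<open>Backward induction\<close>

theorem theorem1:
  fixes T :: nat and K c h \<pi> :: real and W :: "nat \<Rightarrow> nat" and p :: "nat \<Rightarrow> real"
  assumes "T \<ge> 1" and "K \<ge> 0" and "c \<ge> 0" and "h > 0" and "\<pi> > 0"
    and "\<And>t. t \<in> {1..T} \<Longrightarrow> p t \<in> {0..1}"
  shows "\<forall>t\<in>{1..T}.
    K_convex K (G_fn T K c h \<pi> W p t) \<and>
    K_convex K (value_fn T K c h \<pi> W p t) \<and>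
    (\<exists>s S. s \<le> S \<and>
      (\<forall>x. let y = x + sS_hiring s S x;
               J = bellman_cost K c h \<pi> W p t (value_fn T K c h \<pi> W p (t + 1)) x
           in is_arg_min J (\<lambda>y. y \<ge> x) y \<and> value_fn T K c h \<pi> W p t x = J y))"
proof -
  let ?C = "value_fn T K c h \<pi> W p"
  have C_eq: "?C t = (\<lambda>x. INF y\<in>{x..}. bellman_cost K c h \<pi> W p t (?C (t + 1)) x y)"
    if "t \<le> T" for t
    using that by (subst value_fn.simps) simp
  have invariant: "K_convex K (?C t) \<and> (\<forall>x. ?C t x \<ge> 0)" if "1 \<le> t" "t \<le> T + 1" for t
    using that(2,1)
  proof (induction rule: inc_induct)
    case base
    have "?C (T + 1) = (\<lambda>x. 0)"
      by (subst value_fn.simps) simp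
    then show ?case
      using \<open>K \<ge> 0\<close> by (simp add: K_convex_def)
  next
    case (step t)
    then have "t \<le> T" "p t \<in> {0..1}" "K_convex K (?C (t + 1))" "\<And>x. ?C (t + 1) x \<ge> 0"
      using assms(6) by auto
    then show ?case
      using bellman_step(2,3)[OF assms(2-5), of p t "?C (t + 1)" W] C_eq[of t] by simp
  qed
  show ?thesis
  proof
    fix t
    assume t: "t \<in> {1..T}"
    have next_period: "K_convex K (?C (t + 1))" "\<And>x. ?C (t + 1) x \<ge> 0"
      using invariant[of "t + 1"] t by auto
    note step = bellman_step[where p = p and W = W, OF assms(2-5) assms(6)[OF t] next_period]
    show "K_convex K (G_fn T K c h \<pi> W p t) \<and> K_convex K (?C t) \<and>
      (\<exists>s S. s \<le> S \<and> (\<forall>x. let y = x + sS_hiring s S x;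
               J = bellman_cost K c h \<pi> W p t (?C (t + 1)) x
           in is_arg_min J (\<lambda>y. y \<ge> x) y \<and> ?C t x = J y))"
      using step(1,4) invariant[of t] C_eq[of t] t by (simp add: G_fn_def[abs_def] Let_def)
  qed
qed

end
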